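(* Let $\mathsf{K}$ and $\mathsf{L}$ be kernels on $S$. Then the infimum $\mathsf{K}\wedge\mathsf{L}$ of $\mathsf{K}$ and $\mathsf{L}$ exists (in the set of kernels on $S$ ordered by $\prec$) if and only if $\mathbf{D}_{\mathsf{K}}\mathsf{L}$ and $\mathbf{D}_{\mathsf{L}}\mathsf{K}$ are comparable, i.e. $\mathbf{D}_{\mathsf{K}}\mathsf{L}\prec\mathbf{D}_{\mathsf{L}}\mathsf{K}$ or $\mathbf{D}_{\mathsf{L}}\mathsf{K}\prec\mathbf{D}_{\mathsf{K}}\mathsf{L}$.
   Context: Let $S$ be a non-empty set and $\mathfrak{E}$ a complex Banach space with topological dual $\mathfrak{E}^{*}$. The dual pairing $\langle\cdot,\cdot\rangle:\mathfrak{E}\times\mathfrak{E}^{*}\to\mathbb{C}$ is taken linear in the first and conjugate linear in the second variable (the vector space structure of $\mathfrak{E}^*$ is chosen accordingly). $\mathbf{B}(\mathfrak{E},\mathfrak{E}^{*})$ is the space of bounded linear operators from $\mathfrak{E}$ to $\mathfrak{E}^*$. $\mathfrak{X}$ is the complex linear space of finitely supported functions $f:S\to\mathfrak{E}$. A kernel on $S$ is a function $\mathsf{K}:S\times S\to\mathbf{B}(\mathfrak{E},\mathfrak{E}^{*})$ with $\sum_{s,t\in S}\langle f(t),\mathsf{K}(s,t)f(s)\rangle\ge0$ for all $f\in\mathfrak{X}$. A form on $\mathfrak{X}$ is a map $\mathfrak{t}:\mathfrak{X}\times\mathfrak{X}\to\mathbb{C}$, linear in the first and antilinear in the second argument, with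 $\mathfrak{t}[x]:=\mathfrak{t}(x,x)\ge0$ for all $x$. Write $\mathfrak{t}\le\mathfrak{w}$ if $\mathfrak{t}[x]\le\mathfrak{w}[x]$ for all $x$. The parallel sum of forms is the form given by $(\mathfrak{t}:\mathfrak{w})[x]=\inf_{y\in\mathfrak{X}}\{\mathfrak{t}[x-y]+\mathfrak{w}[y]\}$, and $\mathbf{D}_{\mathfrak{w}}\mathfrak{t}:=\sup_{n\in\mathbb{N}}(\mathfrak{t}:n\mathfrak{w})$ (pointwise supremum of quadratic forms), which is a form with $\mathbf{D}_{\mathfrak{w}}\mathfrak{t}\le\mathfrak{t}$. The form associated with a kernel $\mathsf{K}$ is $\mathfrak{w}_{\mathsf{K}}(f,g)=\sum_{s,t\in S}\langle f(t),\mathsf{K}(s,t)g(s)\rangle$; write $\mathsf{K}\prec\mathsf{L}$ if $\mathfrak{w}_{\mathsf{K}}\le\mathfrak{w}_{\mathsf{L}}$. Every form $\mathfrak{w}\le\mathfrak{w}_{\mathsf{K}}$ is the associated form of a unique kernel; $\mathbf{D}_{\mathsf{L}}\mathsf{K}$ denotes the unique kernel whose associated form is $\mathbf{D}_{\mathfrak{w}_{\mathsf{L}}}\mathfrak{w}_{\mathsf{K}}$. The infimum $\mathsf{K}\wedge\mathsf{L}$ is the greatest lower bound: a kernel with $\mathsf{K}\wedge\mathsf{L}\prec\mathsf{K}$, $\mathsf{K}\wedge\mathsf{L}\prec\mathsf{L}$, and such that every kernel $\mathsf{U}$ with $\mathsf{U}\prec\mathsf{K}$ and $\mathsf{U}\prec\mathsf{L}$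 satisfies $\mathsf{U}\prec\mathsf{K}\wedge\mathsf{L}$. *)

theory Defs
  imports "HOL-Analysis.Analysis" "HOL-Library.Poly_Mapping" "HOL-Library.Nonpos_Ints"
begin

class complex_vector = ab_group_add +
  fixes scaleC :: "complex \<Rightarrow> 'a \<Rightarrow> 'a" (infixr "*\<^sub>C" 75)
  assumes scaleC_add_right: "a *\<^sub>C (x + y) = a *\<^sub>C x + a *\<^sub>C y"
    and scaleC_add_left: "(a + b) *\<^sub>C x = a *\<^sub>C x + b *\<^sub>C x"
    and scaleC_scaleC: "a *\<^sub>C (b *\<^sub>C x) = (a * b) *\<^sub>C x"
    and scaleC_one: "1 *\<^sub>C x = x"

text \<open>Completeness comes from \<open>banach\<close>; the two axioms say that the complex scaling extends the
  real one and that the norm is homogeneous over the complex numbers.\<close>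

class complex_banach = banach + complex_vector +
  assumes scaleR_scaleC: "r *\<^sub>R x = complex_of_real r *\<^sub>C x"
    and norm_scaleC: "norm (a *\<^sub>C x) = cmod a * norm x"

instantiation complex :: complex_banach
begin
definition "scaleC_complex a (x::complex) = a * x"
instance
  by standard (auto simp: scaleC_complex_def algebra_simps norm_mult scaleR_conv_of_real)
end

lemma scaleC_zero_right [simp]: "a *\<^sub>C (0::'a::complex_vector) = 0"
  using scaleC_add_right[of a "0::'a" 0] by simp

text \<open>The space of finitely supported functions is the type \<^typ>\<open>'s \<Rightarrow>\<^sub>0 'e\<close>, with pointwise
  operations.\<close>

instantiation poly_mapping :: (type, complex_vector) complex_vector
begin
definition scaleC_poly_mapping :: "complex \<Rightarrow> ('a \<Rightarrow>\<^sub>0 'b) \<Rightarrow> 'a \<Rightarrow>\<^sub>0 'b" where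
  "scaleC_poly_mapping a f = Poly_Mapping.map (\<lambda>x. a *\<^sub>C x) f"
instance
proof -
  have l: "Poly_Mapping.lookup (a *\<^sub>C f) s = a *\<^sub>C Poly_Mapping.lookup f s" for a s and f :: "'a \<Rightarrow>\<^sub>0 'b"
    by (simp add: scaleC_poly_mapping_def Poly_Mapping.map.rep_eq when_def)
  show "OFCLASS('a \<Rightarrow>\<^sub>0 'b, complex_vector_class)"
    by standard (rule poly_mapping_eqI, simp add: l lookup_add scaleC_add_right scaleC_add_left
        scaleC_scaleC scaleC_one)+
qed
end


text \<open>The dual consists of the complex-linear members of the real Banach space of real-linear
  bounded functionals; its norm is the operator norm.\<close>

definition topological_dual :: "('e::complex_banach \<Rightarrow>\<^sub>L complex) set" where
  "topological_dual = {\<phi>. \<forall>c x. blinfun_apply \<phi> (c *\<^sub>C x) = c * blinfun_apply \<phi> x}"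

definition dual_pairing :: "'e::complex_banach \<Rightarrow> ('e \<Rightarrow>\<^sub>L complex) \<Rightarrow> complex" where
  "dual_pairing x \<phi> = blinfun_apply \<phi> x"

text \<open>Bounded linear operators from \<open>E\<close> to its dual \<open>E*\<close>. The pairing is conjugate linear in its
  second argument, so scalar multiplication on \<open>E*\<close> is \<open>(c \<phi>)(y) = cnj c * \<phi>(y)\<close>; the last
  condition is therefore \<open>T (c x) = c (T x)\<close> in \<open>E*\<close>.\<close>

definition bounded_operators_to_dual :: "('e::complex_banach \<Rightarrow>\<^sub>L 'e \<Rightarrow>\<^sub>L complex) set" where
  "bounded_operators_to_dual =
     {T. (\<forall>x. blinfun_apply T x \<in> topological_dual) \<and>
         (\<forall>c x y. dual_pairing y (blinfun_apply T (c *\<^sub>C x)) =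
                   cnj c * dual_pairing y (blinfun_apply T x))}"


definition is_form :: "('x::complex_vector \<Rightarrow> 'x \<Rightarrow> complex) \<Rightarrow> bool" where
  "is_form t \<longleftrightarrow>
     (\<forall>x y z. t (x + y) z = t x z + t y z) \<and>
     (\<forall>c x y. t (c *\<^sub>C x) y = c * t x y) \<and>
     (\<forall>x y z. t x (y + z) = t x y + t x z) \<and>
     (\<forall>c x y. t x (c *\<^sub>C y) = cnj c * t x y) \<and>
     (\<forall>x. t x x \<in> \<real>\<^sub>\<ge>\<^sub>0)"

definition quad :: "('x \<Rightarrow> 'x \<Rightarrow> complex) \<Rightarrow> 'x \<Rightarrow> real" where
  "quad t x = Re (t x x)"

definition form_le :: "('x \<Rightarrow> 'x \<Rightarrow> complex) \<Rightarrow> ('x \<Rightarrow> 'x \<Rightarrow> complex) \<Rightarrow> bool" where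
  "form_le t w \<longleftrightarrow> (\<forall>x. quad t x \<le> quad w x)"

text \<open>A form is determined by its quadratic form (polarization), which is how the next two
  operations are specified. For forms \<open>t\<close> and \<open>w\<close> the infimum is over a set of nonnegative reals
  and the supremum is bounded by \<open>t[x]\<close>.\<close>

definition parallel_sum ::
  "('x::complex_vector \<Rightarrow> 'x \<Rightarrow> complex) \<Rightarrow> ('x \<Rightarrow> 'x \<Rightarrow> complex) \<Rightarrow> 'x \<Rightarrow> 'x \<Rightarrow> complex" where
  "parallel_sum t w =
     (THE p. is_form p \<and> (\<forall>x. quad p x = (INF y. quad t (x - y) + quad w y)))"

definition D_form ::
  "('x::complex_vector \<Rightarrow> 'x \<Rightarrow> complex) \<Rightarrow> ('x \<Rightarrow> 'x \<Rightarrow> complex) \<Rightarrow> 'x \<Rightarrow> 'x \<Rightarrow> complex" where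
  "D_form w t =
     (THE p. is_form p \<and>
        (\<forall>x. quad p x = (SUP n::nat. quad (parallel_sum t (\<lambda>x y. of_nat n * w x y)) x)))"


text \<open>The sum over all pairs in \<open>S \<times> S\<close>; terms outside the supports of \<open>f\<close> and \<open>g\<close> vanish.\<close>

definition assoc_form ::
  "('s \<Rightarrow> 's \<Rightarrow> 'e::complex_banach \<Rightarrow>\<^sub>L 'e \<Rightarrow>\<^sub>L complex) \<Rightarrow> ('s \<Rightarrow>\<^sub>0 'e) \<Rightarrow> ('s \<Rightarrow>\<^sub>0 'e) \<Rightarrow> complex" where
  "assoc_form K f g =
     (\<Sum>s\<in>Poly_Mapping.keys g. \<Sum>t\<in>Poly_Mapping.keys f.
       dual_pairing (Poly_Mapping.lookup f t)
         (blinfun_apply (K s t) (Poly_Mapping.lookup g s)))"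

definition is_kernel :: "('s \<Rightarrow> 's \<Rightarrow> 'e::complex_banach \<Rightarrow>\<^sub>L 'e \<Rightarrow>\<^sub>L complex) \<Rightarrow> bool" where
  "is_kernel K \<longleftrightarrow>
     (\<forall>s t. K s t \<in> bounded_operators_to_dual) \<and> (\<forall>f. assoc_form K f f \<in> \<real>\<^sub>\<ge>\<^sub>0)"

definition kernel_le ::
  "('s \<Rightarrow> 's \<Rightarrow> 'e::complex_banach \<Rightarrow>\<^sub>L 'e \<Rightarrow>\<^sub>L complex) \<Rightarrow> ('s \<Rightarrow> 's \<Rightarrow> 'e \<Rightarrow>\<^sub>L 'e \<Rightarrow>\<^sub>L complex) \<Rightarrow> bool"
  where "kernel_le K L \<longleftrightarrow> form_le (assoc_form K) (assoc_form L)"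

definition D_kernel ::
  "('s \<Rightarrow> 's \<Rightarrow> 'e::complex_banach \<Rightarrow>\<^sub>L 'e \<Rightarrow>\<^sub>L complex) \<Rightarrow> ('s \<Rightarrow> 's \<Rightarrow> 'e \<Rightarrow>\<^sub>L 'e \<Rightarrow>\<^sub>L complex)
    \<Rightarrow> 's \<Rightarrow> 's \<Rightarrow> 'e \<Rightarrow>\<^sub>L 'e \<Rightarrow>\<^sub>L complex" where
  "D_kernel L K = (THE M. is_kernel M \<and> assoc_form M = D_form (assoc_form L) (assoc_form K))"

definition is_kernel_inf ::
  "('s \<Rightarrow> 's \<Rightarrow> 'e::complex_banach \<Rightarrow>\<^sub>L 'e \<Rightarrow>\<^sub>L complex) \<Rightarrow> ('s \<Rightarrow> 's \<Rightarrow> 'e \<Rightarrow>\<^sub>L 'e \<Rightarrow>\<^sub>L complex)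
    \<Rightarrow> ('s \<Rightarrow> 's \<Rightarrow> 'e \<Rightarrow>\<^sub>L 'e \<Rightarrow>\<^sub>L complex) \<Rightarrow> bool" where
  "is_kernel_inf K L M \<longleftrightarrow>
     is_kernel M \<and> kernel_le M K \<and> kernel_le M L \<and>
     (\<forall>U. is_kernel U \<and> kernel_le U K \<and> kernel_le U L \<longrightarrow> kernel_le U M)"

end

(* Every common lower bound of t and w is below both D_w t and D_t w, so if these are comparable
   then the smaller one is the infimum. For the converse, write t' for the dual quadratic form
   t'(f) = sup_x (2 Re f(x) - t[x]) on linear functionals. For c > 0 the rank-one form |f|^2 is at
   most c t iff t'(f) <= c, so an infimum m of t and w satisfies m' = max (t', w') on the functionals
   bounded with respect to both t and w. A maximum of two quadratic forms is a quadratic form only if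
   one of them dominates the other, since a vector space is not the union of two proper subspaces.
   Say w' <= t'. The parallel sum of t and n w is the supremum of the rank-one forms below it, and
   these are below w; hence D_w t <= w. So D_w t is a common lower bound, and therefore below D_t w.
   Kernels inherit the result because every form below the form of a kernel comes from a kernel. *)

theory Submission
  imports Defs
begin

section \<open>Scalar arithmetic in complex vector spaces\<close>

lemma scaleC_zero_left [simp]: "0 *\<^sub>C (x::'x::complex_vector) = 0"
  using scaleC_add_left[of 0 0 x] by simp

lemma scaleC_minus_one [simp]: "(-1) *\<^sub>C (x::'x::complex_vector) = - x"
  using scaleC_add_left[of 1 "-1" x] by (simp add: scaleC_one add_eq_0_iff)

lemma scaleC_minus_right: "c *\<^sub>C (- x::'x::complex_vector) = - (c *\<^sub>C x)"
  by (metis add_eq_0_iff scaleC_add_right scaleC_zero_right)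

lemma scaleC_diff_right: "c *\<^sub>C (x - y::'x::complex_vector) = c *\<^sub>C x - c *\<^sub>C y"
  using scaleC_add_right[of c x "- y"] by (simp add: scaleC_minus_right)

lemma scaleC_two: "2 *\<^sub>C (x::'x::complex_vector) = x + x"
  using scaleC_add_left[of 1 1 x] by (simp add: scaleC_one)

lemma scaleC_half_twice: "(1/2) *\<^sub>C (x + x::'x::complex_vector) = x"
  by (simp add: scaleC_one scaleC_scaleC flip: scaleC_two)

text \<open>Puts an arbitrary pair into the shape to which a parallelogram law applies.\<close>

lemma sum_difference_decomp:
  fixes x y :: "'x::complex_vector"
  obtains a b where "x = a + b" "y = a - b"
proof
  show "x = (1/2) *\<^sub>C (x + y) + (1/2) *\<^sub>C (x - y)" "y = (1/2) *\<^sub>C (x + y) - (1/2) *\<^sub>C (x - y)"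
    unfolding scaleC_add_right[symmetric] scaleC_diff_right[symmetric]
    using scaleC_half_twice[of x] scaleC_half_twice[of y] by (simp_all add: algebra_simps)
qed

section \<open>Nonnegative forms\<close>

lemma form_add_left: "is_form t \<Longrightarrow> t (x + y) z = t x z + t y z"
  and form_scale_left: "is_form t \<Longrightarrow> t (c *\<^sub>C x) z = c * t x z"
  and form_add_right: "is_form t \<Longrightarrow> t z (x + y) = t z x + t z y"
  and form_scale_right: "is_form t \<Longrightarrow> t z (c *\<^sub>C x) = cnj c * t z x"
  and form_nonneg_Reals: "is_form t \<Longrightarrow> t x x \<in> \<real>\<^sub>\<ge>\<^sub>0"
  by (auto simp: is_form_def)

lemma form_diff_left: "is_form t \<Longrightarrow> t (x - y) z = t x z - t y z"
  using form_add_left[of t x "(-1) *\<^sub>C y" z] form_scale_left[of t "-1" y z] by simp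

lemma form_diff_right: "is_form t \<Longrightarrow> t z (x - y) = t z x - t z y"
  using form_add_right[of t z x "(-1) *\<^sub>C y"] form_scale_right[of t z "-1" y] by simp

lemma form_zero_left: "is_form t \<Longrightarrow> t 0 z = 0"
  using form_diff_left[of t 0 0 z] by simp

lemma form_zero_right: "is_form t \<Longrightarrow> t z 0 = 0"
  using form_diff_right[of t z 0 0] by simp

lemmas form_simps = form_add_left form_scale_left form_add_right form_scale_right
  form_diff_left form_diff_right form_zero_left form_zero_right

lemma quad_nonneg: "is_form t \<Longrightarrow> 0 \<le> quad t x"
  using form_nonneg_Reals[of t x] by (simp add: quad_def complex_nonneg_Reals_iff)

lemma form_diag: "is_form t \<Longrightarrow> t x x = of_real (quad t x)"
  using form_nonneg_Reals[of t x] by (simp add: quad_def complex_nonneg_Reals_iff complex_eq_iff)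

text \<open>Follows from the diagonal being real: at \<open>x + y\<close> this fixes the imaginary
  parts, at \<open>i x + y\<close> the real parts.\<close>

lemma form_cnj:
  assumes "is_form t"
  shows "t y x = cnj (t x y)"
proof -
  have im: "Im (t z z) = 0" for z
    by (simp add: form_diag[OF assms])
  have "Im (t (x + y) (x + y)) = 0" "Im (t (\<i> *\<^sub>C x + y) (\<i> *\<^sub>C x + y)) = 0"
    by (rule im)+
  then show ?thesis
    by (simp add: form_simps assms im complex_eq_iff)
qed

lemma quad_scale: "is_form t \<Longrightarrow> quad t (c *\<^sub>C x) = (cmod c)\<^sup>2 * quad t x"
proof -
  assume t: "is_form t"
  have "t (c *\<^sub>C x) (c *\<^sub>C x) = (c * cnj c) * t x x"
    by (simp add: form_scale_left[OF t] form_scale_right[OF t])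
  also have "\<dots> = of_real ((cmod c)\<^sup>2 * quad t x)"
    by (simp only: form_diag[OF t] complex_norm_square[symmetric] of_real_mult)
  finally show "quad t (c *\<^sub>C x) = (cmod c)\<^sup>2 * quad t x"
    by (simp add: quad_def)
qed

lemma quad_add: "is_form t \<Longrightarrow> quad t (x + y) = quad t x + 2 * Re (t x y) + quad t y"
  using form_cnj[of t x y] by (simp add: quad_def form_simps)

lemma quad_diff: "is_form t \<Longrightarrow> quad t (x - y) = quad t x - 2 * Re (t x y) + quad t y"
  using form_cnj[of t x y] by (simp add: quad_def form_simps)

lemma quad_parallelogram:
  "is_form t \<Longrightarrow> quad t (x + y) + quad t (x - y) = 2 * quad t x + 2 * quad t y"
  by (simp add: quad_add quad_diff)

text \<open>Polarization. This is the uniqueness behind the definite descriptions in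
  \<open>parallel_sum\<close> and \<open>D_form\<close>.\<close>

lemma form_eqI:
  assumes "is_form p" "is_form r" "\<And>x. quad p x = quad r x"
  shows "p = r"
proof (intro ext)
  fix x y
  have re: "Re (p x y) = Re (r x y)" for x y
    using assms(3)[of "x + y"] assms(3)[of x] assms(3)[of y]
    by (simp add: quad_add[OF assms(1)] quad_add[OF assms(2)])
  show "p x y = r x y"
    using re[of x y] re[of x "\<i> *\<^sub>C y"]
    by (simp add: complex_eq_iff form_scale_right[OF assms(1)] form_scale_right[OF assms(2)])
qed

lemma form_rank_one:
  assumes "\<And>x y. \<phi> (x + y) = \<phi> x + \<phi> y" "\<And>c x. \<phi> (c *\<^sub>C x) = c * \<phi> x"
  shows "is_form (\<lambda>x y. \<phi> x * cnj (\<phi> y))"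
  unfolding is_form_def
  by (simp add: assms algebra_simps complex_nonneg_Reals_iff complex_mult_cnj)

lemma form_mult:
  assumes "is_form w" "0 \<le> r"
  shows "is_form (\<lambda>x y. of_real r * w x y)"
  unfolding is_form_def
  using assms
  by (simp add: form_simps algebra_simps form_diag quad_nonneg flip: of_real_mult)

lemma quad_mult: "quad (\<lambda>x y. of_real r * w x y) x = r * quad w x"
  by (simp add: quad_def)

text \<open>Expand \<open>t[x - r t(x,y) y] >= 0\<close> for real \<open>r\<close> and take
  \<open>r = 1 / t[y]\<close>. If \<open>t[y] = 0\<close>, the expression is affine in
  \<open>r\<close>, which forces \<open>t(x,y) = 0\<close>.\<close>

lemma form_cauchy_schwarz:
  assumes "is_form t"
  shows "(cmod (t x y))\<^sup>2 \<le> quad t x * quad t y"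
proof -
  have step: "0 \<le> quad t x - 2 * r * (cmod (t x y))\<^sup>2 + r\<^sup>2 * (cmod (t x y))\<^sup>2 * quad t y" for r
  proof -
    let ?c = "of_real r * t x y"
    have "Re (t x (?c *\<^sub>C y)) = r * (cmod (t x y))\<^sup>2"
      unfolding cmod_power2 by (simp add: form_scale_right[OF assms] power2_eq_square algebra_simps)
    moreover have "quad t (?c *\<^sub>C y) = r\<^sup>2 * (cmod (t x y))\<^sup>2 * quad t y"
      by (simp add: quad_scale[OF assms] norm_mult power_mult_distrib)
    ultimately show ?thesis
      using quad_nonneg[OF assms, of "x - ?c *\<^sub>C y"] by (simp add: quad_diff[OF assms])
  qed
  show ?thesis
  proof (cases "quad t y = 0")
    case True
    have "t x y = 0"
    proof (rule ccontr)
      assume "t x y \<noteq> 0"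
      then show False
        using step[of "(quad t x + 1) / (cmod (t x y))\<^sup>2"] quad_nonneg[OF assms, of x] True
        by simp
    qed
    then show ?thesis by (simp add: True)
  next
    case False
    then have pos: "quad t y > 0" using quad_nonneg[OF assms, of y] by simp
    have "(1 / quad t y)\<^sup>2 * (cmod (t x y))\<^sup>2 * quad t y = (cmod (t x y))\<^sup>2 / quad t y"
      using pos by (simp add: power2_eq_square)
    then have "(cmod (t x y))\<^sup>2 / quad t y \<le> quad t x"
      using step[of "1 / quad t y"] by simp
    then show ?thesis using pos by (simp add: pos_divide_le_eq)
  qed
qed

section \<open>Quadratic functionals\<close>

text \<open>Subtracting \<open>c * f 1\<close> leaves an additive function that vanishes on the
  integers, so it depends only on fractional parts and is bounded; a bounded additive function is
  zero.\<close>

lemma additive_bounded_imp_linear: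
  fixes f :: "real \<Rightarrow> real"
  assumes add: "\<And>a b. f (a + b) = f a + f b"
    and bound: "\<And>c. \<bar>c\<bar> \<le> 1 \<Longrightarrow> \<bar>f c\<bar> \<le> B"
  shows "f c = c * f 1"
proof -
  define g where "g c = f c - c * f 1" for c
  have gadd: "g (a + b) = g a + g b" for a b
    by (simp add: g_def add algebra_simps)
  have g0: "g 0 = 0" using gadd[of 0 0] by simp
  have gnat: "g (real n * a) = real n * g a" for n a
    by (induction n) (simp_all add: g0 gadd algebra_simps)
  have gneg: "g (- a) = - g a" for a
    using gadd[of a "- a"] g0 by simp
  have g1: "g 1 = 0" by (simp add: g_def)
  have gint: "g (of_int k) = 0" for k
    using gnat[of "nat \<bar>k\<bar>" 1] gneg[of "of_int k"] g1 by (cases "k \<ge> 0") auto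
  have gB: "\<bar>g a\<bar> \<le> B + \<bar>f 1\<bar>" for a
  proof -
    have "g a = g (frac a)"
      using gadd[of "of_int \<lfloor>a\<rfloor>" "frac a"] gint by (simp add: frac_def)
    moreover have "\<bar>frac a\<bar> \<le> 1" using frac_ge_0[of a] frac_lt_1[of a] by simp
    moreover from this have "\<bar>frac a * f 1\<bar> \<le> \<bar>f 1\<bar>"
      by (simp add: abs_mult mult_left_le_one_le)
    ultimately show ?thesis using bound[of "frac a"] by (simp add: g_def)
  qed
  have "g c = 0"
  proof (rule ccontr)
    assume "g c \<noteq> 0"
    then obtain n where "real n * \<bar>g c\<bar> > B + \<bar>f 1\<bar>"
      using reals_Archimedean3[of "\<bar>g c\<bar>"] by auto
    then show False using gB[of "real n * c"] by (simp add: gnat abs_mult)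
  qed
  then show ?thesis by (simp add: g_def)
qed

text \<open>One inequality suffices in the parallelogram law: its instance at \<open>x + y\<close>, \<open>x - y\<close> is the
  reverse one. Real homogeneity of the polarization follows from additivity and local boundedness.\<close>

lemma jordan_von_neumann:
  fixes q :: "'x::complex_vector \<Rightarrow> real"
  assumes nonneg: "\<And>x. 0 \<le> q x"
    and scale: "\<And>c x. q (c *\<^sub>C x) = (cmod c)\<^sup>2 * q x"
    and le: "\<And>x y. q (x + y) + q (x - y) \<le> 2 * q x + 2 * q y"
  obtains p where "is_form p" "\<And>x. quad p x = q x"
proof -
  have double: "q (x + x) = 4 * q x" for x
    using scale[of 2 x] by (simp add: scaleC_two)
  have q0: "q 0 = 0" using double[of 0] by simp
  have qneg: "q (- x) = q x" for x
    using scale[of "-1" x] by simp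
  have qi: "q (\<i> *\<^sub>C x) = q x" for x
    using scale[of \<i> x] by simp
  have par: "q (x + y) + q (x - y) = 2 * q x + 2 * q y" for x y
    using le[of x y] le[of "x + y" "x - y"] double[of x] double[of y] by (simp add: algebra_simps)
  \<comment> \<open>Polarization: \<open>r\<close> becomes the real part of the form.\<close>
  define r where "r x y = (q (x + y) - q (x - y)) / 4" for x y
  have sym: "r x y = r y x" for x y
    using qneg[of "x - y"] by (simp add: r_def add.commute)
  have add_half: "r x z + r y z = 2 * r ((1/2) *\<^sub>C (x + y)) z" for x y z
  proof -
    obtain a b where ab: "x = a + b" "y = a - b" by (rule sum_difference_decomp)
    have "x + y = a + a" by (simp add: ab)
    then have "(1/2) *\<^sub>C (x + y) = a" by (simp add: scaleC_half_twice)
    moreover have "r x z + r y z = 2 * r a z"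
    proof -
      have eqs: "a + z + b = a + b + z" "a + z - b = a - b + z" "a - z + b = a + b - z" "a - z - b = a - b - z"
        by simp_all
      show ?thesis
        using par[of "a + z" b] par[of "a - z" b] unfolding ab r_def eqs by (simp add: field_simps)
    qed
    ultimately show ?thesis by simp
  qed
  have r0: "r 0 z = 0" for z by (simp add: r_def qneg)
  \<comment> \<open>The midpoint identity for the pair \<open>x + y\<close>, \<open>0\<close>
    identifies twice the midpoint value with \<open>r (x + y) z\<close>.\<close>
  have add: "r (x + y) z = r x z + r y z" for x y z
    using add_half[of x z y] add_half[of "x + y" z 0] r0 by simp
  have bound: "\<bar>r x y\<bar> \<le> (q x + q y) / 2" for x y
    using par[of x y] nonneg[of "x + y"] nonneg[of "x - y"] by (simp add: r_def)
  have real_scale: "r (of_real c *\<^sub>C x) y = c * r x y" for c x y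
  proof -
    have "r (of_real c *\<^sub>C x) y = c * r (of_real 1 *\<^sub>C x) y"
    proof (rule additive_bounded_imp_linear)
      show "r (of_real (a + b) *\<^sub>C x) y = r (of_real a *\<^sub>C x) y + r (of_real b *\<^sub>C x) y" for a b
        by (simp add: scaleC_add_left add)
      show "\<bar>r (of_real c *\<^sub>C x) y\<bar> \<le> (q x + q y) / 2" if "\<bar>c\<bar> \<le> 1" for c :: real
      proof -
        have "c\<^sup>2 * q x \<le> 1 * q x"
          using that nonneg[of x] by (intro mult_right_mono) (simp_all add: abs_square_le_1)
        then show ?thesis using bound[of "of_real c *\<^sub>C x" y] by (simp add: scale)
      qed
    qed
    then show ?thesis by (simp add: scaleC_one)
  qed
  have rneg: "r (- x) y = - r x y" for x y
    using add[of x "- x" y] r0 by simp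
  have rii: "r (\<i> *\<^sub>C x) (\<i> *\<^sub>C y) = r x y" for x y
    by (simp add: r_def qi flip: scaleC_add_right scaleC_diff_right)
  have ri: "r (\<i> *\<^sub>C x) y = - r x (\<i> *\<^sub>C y)" for x y
    using rii[of "\<i> *\<^sub>C x" y] rneg[of x "\<i> *\<^sub>C y"] by (simp add: scaleC_scaleC)
  \<comment> \<open>The imaginary part is forced: antilinearity in \<open>y\<close> gives
    \<open>Im (p x y) = Re (p x (i y))\<close>.\<close>
  define p where "p x y = Complex (r x y) (r x (\<i> *\<^sub>C y))" for x y
  have herm: "p y x = cnj (p x y)" for x y
    using sym[of x y] ri[of x y] sym[of "\<i> *\<^sub>C x" y] by (simp add: p_def complex_eq_iff)
  have padd: "p (x + y) z = p x z + p y z" for x y z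
    by (simp add: p_def add complex_eq_iff)
  have pscale: "p (c *\<^sub>C x) y = c * p x y" for c x y
  proof -
    have split: "c *\<^sub>C x = of_real (Re c) *\<^sub>C x + of_real (Im c) *\<^sub>C (\<i> *\<^sub>C x)"
      using complex_eq[of c] by (simp add: scaleC_scaleC mult.commute flip: scaleC_add_left)
    have "r x (\<i> *\<^sub>C (\<i> *\<^sub>C y)) = - r x y"
      using rneg[of y x] sym[of x y] sym[of x "- y"] by (simp add: scaleC_scaleC)
    then show ?thesis
      unfolding split padd
      by (simp add: p_def real_scale ri rii complex_eq_iff)
  qed
  have diag: "p x x = of_real (q x)" for x
  proof -
    \<comment> \<open>Since \<open>|1 + i|^2 = 2\<close>, the left side is \<open>2 q x\<close>, and
      the parallelogram law gives the same value on the right. Hence \<open>p x x\<close> is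
      real.\<close>
    have "q (x + \<i> *\<^sub>C x) = q (x - \<i> *\<^sub>C x)"
      using scale[of "1 + \<i>" x] par[of x "\<i> *\<^sub>C x"]
      by (simp add: scaleC_add_left scaleC_one cmod_power2 qi)
    then show ?thesis by (simp add: p_def r_def q0 double complex_eq_iff)
  qed
  have "p z (x + y) = p z x + p z y" "p z (c *\<^sub>C x) = cnj c * p z x" for x y z c
    using herm[of z "x + y"] herm[of z x] herm[of z y] herm[of z "c *\<^sub>C x"]
    by (simp_all add: padd pscale)
  then have "is_form p"
    by (simp add: is_form_def padd pscale diag nonneg)
  moreover have "quad p x = q x" for x
    by (simp add: quad_def diag)
  ultimately show thesis using that by blast
qed

section \<open>Parallel sums and absolutely continuous parts\<close>

text \<open>The infimum satisfies the hypotheses of \<open>jordan_von_neumann\<close>, which yields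
  a form; \<open>form_eqI\<close> makes it unique.\<close>

lemma parallel_sum_spec:
  assumes t: "is_form t" and w: "is_form w"
  shows "is_form (parallel_sum t w) \<and>
    (\<forall>x. quad (parallel_sum t w) x = (INF y. quad t (x - y) + quad w y))"
proof -
  define q where "q x = (INF y. quad t (x - y) + quad w y)" for x
  have bdd: "bdd_below (range (\<lambda>y. quad t (x - y) + quad w y))" for x
    by (rule bdd_belowI[of _ 0]) (auto simp: quad_nonneg t w)
  have lower: "q x \<le> quad t (x - y) + quad w y" for x y
    unfolding q_def by (rule cINF_lower[OF bdd]) simp
  have greatest: "c \<le> q x" if "\<And>y. c \<le> quad t (x - y) + quad w y" for c x
    unfolding q_def by (rule cINF_greatest) (simp_all add: that)
  have nonneg: "0 \<le> q x" for x
    by (rule greatest) (simp add: quad_nonneg t w)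
  have scale_le: "q (c *\<^sub>C x) \<le> (cmod c)\<^sup>2 * q x" for c x
  proof (cases "c = 0")
    case True
    then show ?thesis using lower[of 0 0] by (simp add: quad_def form_simps t w)
  next
    case False
    have "q (c *\<^sub>C x) / (cmod c)\<^sup>2 \<le> q x"
    proof (rule greatest)
      fix y
      have "q (c *\<^sub>C x) \<le> (cmod c)\<^sup>2 * (quad t (x - y) + quad w y)"
        using lower[of "c *\<^sub>C x" "c *\<^sub>C y"]
        by (simp add: quad_scale t w algebra_simps flip: scaleC_diff_right)
      then show "q (c *\<^sub>C x) / (cmod c)\<^sup>2 \<le> quad t (x - y) + quad w y"
        using False by (simp add: field_simps)
    qed
    then show ?thesis using False by (simp add: field_simps)
  qed
  have scale: "q (c *\<^sub>C x) = (cmod c)\<^sup>2 * q x" for c x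
  proof (cases "c = 0")
    case True
    then show ?thesis using scale_le[of 0 x] nonneg[of 0] by simp
  next
    case False
    then have "q x \<le> (cmod (1 / c))\<^sup>2 * q (c *\<^sub>C x)"
      using scale_le[of "1 / c" "c *\<^sub>C x"] by (simp add: scaleC_scaleC scaleC_one)
    then have "(cmod c)\<^sup>2 * q x \<le> q (c *\<^sub>C x)"
      using False by (simp add: norm_divide power_divide field_simps)
    then show ?thesis using scale_le[of c x] by simp
  qed
  have par: "q (x + y) + q (x - y) \<le> 2 * q x + 2 * q y" for x y
  proof -
    \<comment> \<open>The competitors \<open>a\<close> for \<open>x\<close> and \<open>b\<close> for
      \<open>y\<close> combine to \<open>a + b\<close> for \<open>x + y\<close> and
      \<open>a - b\<close> for \<open>x - y\<close>; the parallelogram laws of \<open>t\<close> and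
      \<open>w\<close> add up the costs.\<close>
    have key: "q (x + y) + q (x - y) \<le>
        2 * (quad t (x - a) + quad w a) + 2 * (quad t (y - b) + quad w b)" for a b
      using lower[of "x + y" "a + b"] lower[of "x - y" "a - b"]
        quad_parallelogram[OF t, of "x - a" "y - b"] quad_parallelogram[OF w, of a b]
      by (simp add: algebra_simps)
    have "(q (x + y) + q (x - y) - 2 * (quad t (y - b) + quad w b)) / 2 \<le> q x" for b
      by (rule greatest) (use key[of _ b] in \<open>simp add: field_simps\<close>)
    then have "(q (x + y) + q (x - y) - 2 * q x) / 2 \<le> q y"
      by (intro greatest) (simp add: field_simps)
    then show ?thesis by (simp add: field_simps)
  qed
  obtain p where p: "is_form p" "\<And>x. quad p x = q x"
    using jordan_von_neumann[of q] nonneg scale par by metis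
  show ?thesis
    unfolding parallel_sum_def
    by (rule theI[of _ p]) (auto simp: p q_def[symmetric] intro: form_eqI)
qed

section \<open>Elementary bounds on parallel sums\<close>

lemma parallel_sum_form: "is_form t \<Longrightarrow> is_form w \<Longrightarrow> is_form (parallel_sum t w)"
  using parallel_sum_spec by blast

lemma parallel_sum_le:
  assumes "is_form t" "is_form w"
  shows "quad (parallel_sum t w) x \<le> quad t (x - y) + quad w y"
proof -
  have "bdd_below (range (\<lambda>y. quad t (x - y) + quad w y))"
    by (rule bdd_belowI[of _ 0]) (auto simp: quad_nonneg assms)
  then show ?thesis
    using parallel_sum_spec[OF assms] by (auto intro: cINF_lower)
qed

lemma parallel_sum_greatest:
  assumes "is_form t" "is_form w" "\<And>y. c \<le> quad t (x - y) + quad w y"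
  shows "c \<le> quad (parallel_sum t w) x"
  using parallel_sum_spec[OF assms(1,2)] assms(3) by (auto intro: cINF_greatest)

lemma parallel_sum_le_left:
  "is_form t \<Longrightarrow> is_form w \<Longrightarrow> quad (parallel_sum t w) x \<le> quad t x"
  using parallel_sum_le[of t w x 0] by (simp add: quad_def form_simps)

lemma parallel_sum_le_right:
  "is_form t \<Longrightarrow> is_form w \<Longrightarrow> quad (parallel_sum t w) x \<le> quad w x"
  using parallel_sum_le[of t w x x] by (simp add: quad_def form_simps)

lemma form_of_nat_mult: "is_form w \<Longrightarrow> is_form (\<lambda>x y. of_nat n * w x y)"
  using form_mult[of w "real n"] by simp

lemma quad_of_nat_mult: "quad (\<lambda>x y. of_nat n * w x y) x = real n * quad w x"
  using quad_mult[of "real n" w x] by simp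

text \<open>The parallel sums increase with \<open>n\<close> and stay below \<open>t[x]\<close>, so
  the supremum is a limit, and homogeneity and the parallelogram law pass to limits.\<close>

lemma D_form_spec:
  assumes t: "is_form t" and w: "is_form w"
  shows "is_form (D_form w t)"
    and "(\<lambda>n. quad (parallel_sum t (\<lambda>x y. of_nat n * w x y)) x) \<longlonglongrightarrow> quad (D_form w t) x"
proof -
  define u where "u n = parallel_sum t (\<lambda>x y. of_nat n * w x y)" for n :: nat
  have u: "is_form (u n)" for n
    unfolding u_def by (intro parallel_sum_form t form_of_nat_mult w)
  have le: "quad (u n) x \<le> quad t x" for n x
    unfolding u_def by (intro parallel_sum_le_left t form_of_nat_mult w)
  have inc: "incseq (\<lambda>n. quad (u n) x)" for x
  proof (rule incseq_SucI)
    fix n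
    show "quad (u n) x \<le> quad (u (Suc n)) x"
      unfolding u_def
    proof (rule parallel_sum_greatest[OF t form_of_nat_mult[OF w]])
      fix y
      show "quad (parallel_sum t (\<lambda>x y. of_nat n * w x y)) x
          \<le> quad t (x - y) + quad (\<lambda>x y. of_nat (Suc n) * w x y) y"
        using parallel_sum_le[OF t form_of_nat_mult[OF w], of n x y] quad_nonneg[OF w, of y]
        unfolding quad_of_nat_mult by (simp add: algebra_simps)
    qed
  qed
  define q where "q x = (SUP n. quad (u n) x)" for x
  have lim: "(\<lambda>n. quad (u n) x) \<longlonglongrightarrow> q x" for x
    unfolding q_def by (rule LIMSEQ_incseq_SUP[OF _ inc]) (auto intro: bdd_aboveI[of _ "quad t x"] le)
  have nonneg: "0 \<le> q x" for x
    by (rule LIMSEQ_le_const[OF lim]) (simp add: quad_nonneg u)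
  have scale: "q (c *\<^sub>C x) = (cmod c)\<^sup>2 * q x" for c x
    using LIMSEQ_unique[OF lim[of "c *\<^sub>C x"]] tendsto_mult[OF tendsto_const lim[of x]]
    by (simp add: quad_scale u)
  have par: "q (x + y) + q (x - y) \<le> 2 * q x + 2 * q y" for x y
  proof (rule LIMSEQ_le)
    show "(\<lambda>n. quad (u n) (x + y) + quad (u n) (x - y)) \<longlonglongrightarrow> q (x + y) + q (x - y)"
      "(\<lambda>n. 2 * quad (u n) x + 2 * quad (u n) y) \<longlonglongrightarrow> 2 * q x + 2 * q y"
      by (intro tendsto_intros lim)+
  qed (simp add: quad_parallelogram u)
  obtain p where p: "is_form p" "\<And>x. quad p x = q x"
    using jordan_von_neumann[of q] nonneg scale par by metis
  have "is_form (D_form w t) \<and> (\<forall>x. quad (D_form w t) x = q x)"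
    unfolding D_form_def q_def u_def
    by (rule theI[of _ p]) (auto simp: p q_def[symmetric] u_def[symmetric] intro: form_eqI)
  then show "is_form (D_form w t)"
    "(\<lambda>n. quad (parallel_sum t (\<lambda>x y. of_nat n * w x y)) x) \<longlonglongrightarrow> quad (D_form w t) x"
    using lim[of x] by (simp_all add: u_def)
qed

lemma D_form_le:
  assumes "is_form t" "is_form w"
  shows "form_le (D_form w t) t"
  unfolding form_le_def
proof
  fix x
  show "quad (D_form w t) x \<le> quad t x"
    by (rule LIMSEQ_le_const2[OF D_form_spec(2)[OF assms]])
      (simp add: parallel_sum_le_left assms form_of_nat_mult)
qed

text \<open>Parallel sums are monotone in both arguments, and that of \<open>u\<close> and
  \<open>n u\<close> is \<open>n/(n+1) u\<close>, which tends to \<open>u\<close>.\<close>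

lemma lower_bound_le_D_form:
  assumes u: "is_form u" and t: "is_form t" and w: "is_form w"
    and "form_le u t" "form_le u w"
  shows "form_le u (D_form w t)"
  unfolding form_le_def
proof
  fix x
  have "real n / real (Suc n) * quad u x \<le> quad (parallel_sum t (\<lambda>x y. of_nat n * w x y)) x" for n
  proof (rule parallel_sum_greatest[OF t form_of_nat_mult[OF w]])
    fix y
    have norm: "cmod (of_nat (Suc n)) = real n + 1"
      using norm_of_nat[of "Suc n", where ?'a = complex] by simp
    have "Re (u x (of_nat (Suc n) *\<^sub>C y)) = (real n + 1) * Re (u x y)"
      by (simp add: form_scale_right[OF u] algebra_simps)
    \<comment> \<open>Completing the square: the minimum of \<open>u[x - y] + n u[y]\<close> over
      \<open>y\<close> is attained at \<open>y = x/(n+1)\<close>.\<close>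
    then have "quad u (x - of_nat (Suc n) *\<^sub>C y) =
        (real n + 1) * (quad u (x - y) + n * quad u y) - n * quad u x"
      unfolding quad_diff[OF u] quad_scale[OF u] norm by (simp add: power2_eq_square algebra_simps)
    with quad_nonneg[OF u, of "x - of_nat (Suc n) *\<^sub>C y"]
    have "real n * quad u x \<le> (real n + 1) * (quad u (x - y) + n * quad u y)"
      by simp
    then have "real n / real (Suc n) * quad u x \<le> quad u (x - y) + n * quad u y"
      by (simp add: field_simps)
    also have "\<dots> \<le> quad t (x - y) + n * quad w y"
      using assms(4,5) by (intro add_mono mult_left_mono) (auto simp: form_le_def)
    finally show "real n / real (Suc n) * quad u x
        \<le> quad t (x - y) + quad (\<lambda>x y. of_nat n * w x y) y"
      by (simp add: quad_of_nat_mult)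
  qed
  moreover have "(\<lambda>n. real n / real (Suc n) * quad u x) \<longlonglongrightarrow> 1 * quad u x"
    by (intro tendsto_intros LIMSEQ_n_over_Suc_n)
  ultimately show "quad u x \<le> quad (D_form w t) x"
    using LIMSEQ_le[OF _ D_form_spec(2)[OF t w]] by fastforce
qed

section \<open>Dual quadratic forms\<close>

text \<open>The squared dual norm in Legendre form, which avoids dividing by \<open>t[x]\<close> at
  null vectors. As a real supremum it is meaningful only when the values are bounded above.\<close>

definition dual_quad :: "('x \<Rightarrow> 'x \<Rightarrow> complex) \<Rightarrow> ('x \<Rightarrow> complex) \<Rightarrow> real" where
  "dual_quad t \<phi> = (SUP x. 2 * Re (\<phi> x) - quad t x)"

definition linear_functional :: "('x::complex_vector \<Rightarrow> complex) \<Rightarrow> bool" where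
  "linear_functional \<phi> \<longleftrightarrow>
     (\<forall>x y. \<phi> (x + y) = \<phi> x + \<phi> y) \<and> (\<forall>c x. \<phi> (c *\<^sub>C x) = c * \<phi> x)"

text \<open>For a form \<open>t\<close>, exactly the linear functionals at which the supremum in
  \<open>dual_quad\<close> is finite.\<close>

definition bounded_wrt :: "('x::complex_vector \<Rightarrow> 'x \<Rightarrow> complex) \<Rightarrow> ('x \<Rightarrow> complex) \<Rightarrow> bool" where
  "bounded_wrt t \<phi> \<longleftrightarrow> linear_functional \<phi> \<and> (\<exists>c\<ge>0. \<forall>x. (cmod (\<phi> x))\<^sup>2 \<le> c * quad t x)"

lemma bounded_wrt_linear: "bounded_wrt t \<phi> \<Longrightarrow> linear_functional \<phi>"
  by (simp add: bounded_wrt_def)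

text \<open>Forwards this is the inequality of arithmetic and geometric means; backwards,
  \<open>x\<close> is multiplied by \<open>r cnj (\<phi> x)\<close> and the real factor
  \<open>r\<close> is optimized.\<close>

lemma dominated_iff:
  assumes t: "is_form t" and \<phi>: "linear_functional \<phi>" and "0 \<le> c"
  shows "(\<forall>x. (cmod (\<phi> x))\<^sup>2 \<le> c * quad t x) \<longleftrightarrow> (\<forall>x. 2 * Re (\<phi> x) - quad t x \<le> c)"
proof (intro iffI allI)
  fix x
  assume le: "\<forall>x. (cmod (\<phi> x))\<^sup>2 \<le> c * quad t x"
  have "(2 * cmod (\<phi> x))\<^sup>2 \<le> 4 * (c * quad t x)"
    using le by (simp add: power_mult_distrib)
  also have "\<dots> \<le> (c + quad t x)\<^sup>2"
    using zero_le_power2[of "c - quad t x"] by (simp add: power2_eq_square algebra_simps)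
  finally have "2 * cmod (\<phi> x) \<le> c + quad t x"
    using \<open>0 \<le> c\<close> quad_nonneg[OF t, of x] by (auto intro: power2_le_imp_le)
  then show "2 * Re (\<phi> x) - quad t x \<le> c"
    using complex_Re_le_cmod[of "\<phi> x"] by simp
next
  fix x
  assume le: "\<forall>x. 2 * Re (\<phi> x) - quad t x \<le> c"
  have step: "2 * r * (cmod (\<phi> x))\<^sup>2 - r\<^sup>2 * (cmod (\<phi> x))\<^sup>2 * quad t x \<le> c" for r
  proof -
    let ?a = "of_real r * cnj (\<phi> x)"
    have "Re (\<phi> (?a *\<^sub>C x)) = r * (cmod (\<phi> x))\<^sup>2"
      using \<phi> unfolding cmod_power2 linear_functional_def
      by (simp add: power2_eq_square algebra_simps)
    moreover have "quad t (?a *\<^sub>C x) = r\<^sup>2 * (cmod (\<phi> x))\<^sup>2 * quad t x"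
      by (simp add: quad_scale[OF t] norm_mult power_mult_distrib)
    ultimately show ?thesis
      using le[rule_format, of "?a *\<^sub>C x"] by simp
  qed
  show "(cmod (\<phi> x))\<^sup>2 \<le> c * quad t x"
  proof (cases "quad t x = 0")
    case True
    \<comment> \<open>With \<open>t[x] = 0\<close> the left side of \<open>step\<close> is linear in
      \<open>r\<close>; the chosen \<open>r\<close> gives it the value \<open>2 (c + 1)\<close>,
      which exceeds \<open>c\<close>.\<close>
    have "\<phi> x = 0"
    proof (rule ccontr)
      assume "\<phi> x \<noteq> 0"
      then show False
        using step[of "(c + 1) / (cmod (\<phi> x))\<^sup>2"] \<open>0 \<le> c\<close> True by simp
    qed
    then show ?thesis by (simp add: True)
  next
    case False
    then have pos: "quad t x > 0" using quad_nonneg[OF t, of x] by simp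
    have "(1 / quad t x)\<^sup>2 * (cmod (\<phi> x))\<^sup>2 * quad t x = (cmod (\<phi> x))\<^sup>2 / quad t x"
      using pos by (simp add: power2_eq_square)
    then have "(cmod (\<phi> x))\<^sup>2 / quad t x \<le> c"
      using step[of "1 / quad t x"] by simp
    then show ?thesis using pos by (simp add: pos_divide_le_eq)
  qed
qed

lemma dual_quad_bdd:
  assumes "is_form t" "bounded_wrt t \<phi>"
  shows "bdd_above (range (\<lambda>x. 2 * Re (\<phi> x) - quad t x))"
proof -
  obtain c where "0 \<le> c" "\<forall>x. (cmod (\<phi> x))\<^sup>2 \<le> c * quad t x"
    using assms(2) by (auto simp: bounded_wrt_def)
  then have "\<forall>x. 2 * Re (\<phi> x) - quad t x \<le> c"
    using dominated_iff assms bounded_wrt_linear by blast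
  then show ?thesis by (auto intro: bdd_aboveI)
qed

text \<open>The bridge between order and duality: the dual value is the least \<open>c >= 0\<close>
  for which the rank-one form of \<phi> lies below \<open>c t\<close>.\<close>

lemma dual_quad_le_iff:
  assumes "is_form t" "bounded_wrt t \<phi>" "0 \<le> c"
  shows "dual_quad t \<phi> \<le> c \<longleftrightarrow> (\<forall>x. (cmod (\<phi> x))\<^sup>2 \<le> c * quad t x)"
  unfolding dual_quad_def dominated_iff[OF assms(1) bounded_wrt_linear[OF assms(2)] assms(3)]
  by (subst cSUP_le_iff) (auto simp: dual_quad_bdd assms)

lemma dual_quad_upper:
  assumes "is_form t" "bounded_wrt t \<phi>"
  shows "2 * Re (\<phi> x) - quad t x \<le> dual_quad t \<phi>"
  unfolding dual_quad_def by (rule cSUP_upper[OF _ dual_quad_bdd[OF assms]]) simp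

lemma dual_quad_least: "(\<And>x. 2 * Re (\<phi> x) - quad t x \<le> c) \<Longrightarrow> dual_quad t \<phi> \<le> c"
  unfolding dual_quad_def by (rule cSUP_least) auto

lemma dual_quad_nonneg:
  assumes "is_form t" "bounded_wrt t \<phi>"
  shows "0 \<le> dual_quad t \<phi>"
proof -
  have "\<phi> 0 = 0"
    using bounded_wrt_linear[OF assms(2)] unfolding linear_functional_def by (metis add_cancel_right_left add.right_neutral)
  then show ?thesis
    using dual_quad_upper[OF assms, of 0] by (simp add: quad_def form_zero_left assms)
qed

section \<open>The dual as a quadratic functional\<close>

lemma bounded_wrt_add:
  assumes "bounded_wrt t \<phi>" "bounded_wrt t \<psi>"
  shows "bounded_wrt t (\<lambda>x. \<phi> x + \<psi> x)"
proof -
  obtain c d where cd: "0 \<le> c" "0 \<le> d"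
    "\<And>x. (cmod (\<phi> x))\<^sup>2 \<le> c * quad t x" "\<And>x. (cmod (\<psi> x))\<^sup>2 \<le> d * quad t x"
    using assms unfolding bounded_wrt_def by metis
  have "(cmod (\<phi> x + \<psi> x))\<^sup>2 \<le> (2 * c + 2 * d) * quad t x" for x
  proof -
    have "(cmod (\<phi> x + \<psi> x))\<^sup>2 \<le> (cmod (\<phi> x) + cmod (\<psi> x))\<^sup>2"
      by (simp add: norm_triangle_ineq power_mono)
    also have "\<dots> \<le> 2 * (cmod (\<phi> x))\<^sup>2 + 2 * (cmod (\<psi> x))\<^sup>2"
      using zero_le_power2[of "cmod (\<phi> x) - cmod (\<psi> x)"]
      by (simp add: power2_eq_square algebra_simps)
    also have "\<dots> \<le> (2 * c + 2 * d) * quad t x"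
      using cd(3,4)[of x] by (simp add: algebra_simps)
    finally show ?thesis .
  qed
  moreover have "linear_functional (\<lambda>x. \<phi> x + \<psi> x)"
    using assms by (simp add: bounded_wrt_def linear_functional_def algebra_simps)
  ultimately show ?thesis
    unfolding bounded_wrt_def using cd(1,2) by (metis add_nonneg_nonneg mult_nonneg_nonneg zero_le_numeral)
qed

lemma bounded_wrt_diff:
  assumes "bounded_wrt t \<phi>" "bounded_wrt t \<psi>"
  shows "bounded_wrt t (\<lambda>x. \<phi> x - \<psi> x)"
proof -
  have "bounded_wrt t (\<lambda>x. - \<psi> x)"
    using assms(2) by (simp add: bounded_wrt_def linear_functional_def)
  then show ?thesis
    using bounded_wrt_add[OF assms(1)] by fastforce
qed

text \<open>For one inequality, \<open>x + y\<close> and \<open>x - y\<close> are tested in the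
  suprema on the left; for the other, each pair of test vectors is written as \<open>a + b\<close>,
  \<open>a - b\<close>.\<close>

lemma dual_quad_parallelogram:
  assumes t: "is_form t" and \<phi>: "bounded_wrt t \<phi>" and \<psi>: "bounded_wrt t \<psi>"
  shows "dual_quad t (\<lambda>x. \<phi> x + \<psi> x) + dual_quad t (\<lambda>x. \<phi> x - \<psi> x) =
    2 * dual_quad t \<phi> + 2 * dual_quad t \<psi>" (is "?S + ?D = _")
proof (rule antisym)
  have add: "\<phi> (x + y) = \<phi> x + \<phi> y" "\<psi> (x + y) = \<psi> x + \<psi> y" for x y
    using \<phi> \<psi> by (simp_all add: bounded_wrt_def linear_functional_def)
  have diff: "\<phi> (x - y) = \<phi> x - \<phi> y" "\<psi> (x - y) = \<psi> x - \<psi> y" for x y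
    using add[of "x - y" y] by simp_all
  have "2 * (2 * Re (\<phi> x) - quad t x) + 2 * (2 * Re (\<psi> y) - quad t y) \<le> ?S + ?D" for x y
    using dual_quad_upper[OF t bounded_wrt_add[OF \<phi> \<psi>], of "x + y"]
      dual_quad_upper[OF t bounded_wrt_diff[OF \<phi> \<psi>], of "x - y"] quad_parallelogram[OF t, of x y]
    by (simp add: add diff)
  \<comment> \<open>The suprema are taken one variable at a time, the other variable being held
    fixed.\<close>
  then have "2 * Re (\<phi> x) - quad t x \<le> (?S + ?D - 2 * (2 * Re (\<psi> y) - quad t y)) / 2" for x y
    by (simp add: field_simps)
  then have "dual_quad t \<phi> \<le> (?S + ?D - 2 * (2 * Re (\<psi> y) - quad t y)) / 2" for y
    by (rule dual_quad_least)
  then have "2 * Re (\<psi> y) - quad t y \<le> (?S + ?D - 2 * dual_quad t \<phi>) / 2" for y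
    by (simp add: field_simps)
  then have "dual_quad t \<psi> \<le> (?S + ?D - 2 * dual_quad t \<phi>) / 2"
    by (rule dual_quad_least)
  then show "2 * dual_quad t \<phi> + 2 * dual_quad t \<psi> \<le> ?S + ?D"
    by (simp add: field_simps)
  have key: "(2 * Re (\<phi> x + \<psi> x) - quad t x) + (2 * Re (\<phi> y - \<psi> y) - quad t y)
      \<le> 2 * dual_quad t \<phi> + 2 * dual_quad t \<psi>" for x y
  proof -
    obtain a b where ab: "x = a + b" "y = a - b" by (rule sum_difference_decomp)
    show ?thesis
      using dual_quad_upper[OF t \<phi>, of a] dual_quad_upper[OF t \<psi>, of b]
        quad_parallelogram[OF t, of a b]
      by (simp add: ab add diff)
  qed
  then have "2 * Re (\<phi> x + \<psi> x) - quad t x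
      \<le> 2 * dual_quad t \<phi> + 2 * dual_quad t \<psi> - (2 * Re (\<phi> y - \<psi> y) - quad t y)" for x y
    by (simp add: algebra_simps)
  then have "?S \<le> 2 * dual_quad t \<phi> + 2 * dual_quad t \<psi> - (2 * Re (\<phi> y - \<psi> y) - quad t y)" for y
    by (rule dual_quad_least)
  then have "2 * Re (\<phi> y - \<psi> y) - quad t y \<le> 2 * dual_quad t \<phi> + 2 * dual_quad t \<psi> - ?S" for y
    by (simp add: algebra_simps)
  then have "?D \<le> 2 * dual_quad t \<phi> + 2 * dual_quad t \<psi> - ?S"
    by (rule dual_quad_least)
  then show "?S + ?D \<le> 2 * dual_quad t \<phi> + 2 * dual_quad t \<psi>" by simp
qed

section \<open>Infima of forms\<close>

definition is_form_inf ::
  "('x::complex_vector \<Rightarrow> 'x \<Rightarrow> complex) \<Rightarrow> ('x \<Rightarrow> 'x \<Rightarrow> complex) \<Rightarrow> ('x \<Rightarrow> 'x \<Rightarrow> complex) \<Rightarrow> bool" where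
  "is_form_inf t w m \<longleftrightarrow> is_form m \<and> form_le m t \<and> form_le m w \<and>
     (\<forall>u. is_form u \<and> form_le u t \<and> form_le u w \<longrightarrow> form_le u m)"

text \<open>The rank-one form of \<phi> divided by \<open>c\<close> is a common lower bound of
  \<open>t\<close> and \<open>w\<close>, hence lies below the infimum.\<close>

lemma form_inf_dominates:
  assumes inf: "is_form_inf t w m" and \<phi>: "linear_functional \<phi>" and c: "0 < c"
    and "\<And>x. (cmod (\<phi> x))\<^sup>2 \<le> c * quad t x" "\<And>x. (cmod (\<phi> x))\<^sup>2 \<le> c * quad w x"
  shows "(cmod (\<phi> x))\<^sup>2 \<le> c * quad m x"
proof -
  define u where "u x y = of_real (1 / c) * (\<phi> x * cnj (\<phi> y))" for x y
  have u: "is_form u"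
    unfolding u_def
    by (rule form_mult[OF form_rank_one]) (use \<phi> c in \<open>auto simp: linear_functional_def\<close>)
  have quad: "quad u x = (cmod (\<phi> x))\<^sup>2 / c" for x
    unfolding u_def quad_mult
    by (simp add: quad_def complex_mult_cnj cmod_power2)
  have "form_le u t" "form_le u w"
    using assms(4,5) c by (auto simp: form_le_def quad pos_divide_le_eq mult.commute)
  then have "quad u x \<le> quad m x"
    using inf u by (auto simp: is_form_inf_def form_le_def)
  then show ?thesis
    using c by (simp add: quad pos_divide_le_eq mult.commute)
qed

lemma form_inf_bounded_wrt:
  assumes inf: "is_form_inf t w m" and t: "is_form t" and w: "is_form w"
    and \<phi>: "bounded_wrt t \<phi>" "bounded_wrt w \<phi>"
  shows "bounded_wrt m \<phi>"
proof -
  obtain c d where cd: "0 \<le> c" "0 \<le> d"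
    "\<And>x. (cmod (\<phi> x))\<^sup>2 \<le> c * quad t x" "\<And>x. (cmod (\<phi> x))\<^sup>2 \<le> d * quad w x"
    using \<phi> unfolding bounded_wrt_def by metis
  \<comment> \<open>The summand 1 makes the common constant strictly positive, as
    \<open>form_inf_dominates\<close> requires.\<close>
  have "c * quad t x \<le> (c + d + 1) * quad t x" "d * quad w x \<le> (c + d + 1) * quad w x" for x
    using cd(1,2) quad_nonneg[OF t, of x] quad_nonneg[OF w, of x] by (auto intro: mult_right_mono)
  then have "(cmod (\<phi> x))\<^sup>2 \<le> (c + d + 1) * quad m x" for x
    using form_inf_dominates[OF inf bounded_wrt_linear[OF \<phi>(1)], of "c + d + 1"] cd
    by (smt (verit))
  then show ?thesis
    unfolding bounded_wrt_def using cd(1,2) bounded_wrt_linear[OF \<phi>(1)]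
    by (intro conjI exI[of _ "c + d + 1"]) auto
qed

lemma dual_quad_antimono:
  assumes "form_le m t" "is_form m" "bounded_wrt m \<phi>"
  shows "dual_quad t \<phi> \<le> dual_quad m \<phi>"
proof (rule dual_quad_least)
  fix x
  show "2 * Re (\<phi> x) - quad t x \<le> dual_quad m \<phi>"
    using dual_quad_upper[OF assms(2,3), of x] assms(1) by (auto simp: form_le_def dest: spec[of _ x])
qed

text \<open>Duality reverses the order, so the dual of \<open>m\<close> lies above both others;
  conversely, each \<open>c\<close> above the maximum is admissible for \<open>t\<close> and
  \<open>w\<close>, hence for \<open>m\<close>.\<close>

lemma dual_quad_form_inf:
  assumes inf: "is_form_inf t w m" and t: "is_form t" and w: "is_form w"
    and \<phi>: "bounded_wrt t \<phi>" "bounded_wrt w \<phi>"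
  shows "dual_quad m \<phi> = max (dual_quad t \<phi>) (dual_quad w \<phi>)"
proof (rule antisym)
  have m: "is_form m" "form_le m t" "form_le m w" using inf by (auto simp: is_form_inf_def)
  note bm = form_inf_bounded_wrt[OF assms]
  show "max (dual_quad t \<phi>) (dual_quad w \<phi>) \<le> dual_quad m \<phi>"
    using dual_quad_antimono m bm by auto
  show "dual_quad m \<phi> \<le> max (dual_quad t \<phi>) (dual_quad w \<phi>)"
  \<comment> \<open>The maximum itself may be 0, whereas \<open>form_inf_dominates\<close> takes a
    positive constant.\<close>
  proof (rule dense_ge)
    fix c
    assume c: "max (dual_quad t \<phi>) (dual_quad w \<phi>) < c"
    then have pos: "0 < c" using dual_quad_nonneg[OF t \<phi>(1)] by simp
    have "(cmod (\<phi> x))\<^sup>2 \<le> c * quad m x" for x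
      using form_inf_dominates[OF inf bounded_wrt_linear[OF \<phi>(1)] pos] c pos
        dual_quad_le_iff[OF t \<phi>(1), of c] dual_quad_le_iff[OF w \<phi>(2), of c] by simp
    then show "dual_quad m \<phi> \<le> c"
      using dual_quad_le_iff[OF m(1) bm, of c] pos by simp
  qed
qed

text \<open>The functionals on which the dual of the infimum agrees with the dual of \<open>t\<close> (of \<open>w\<close>) are the
  zeros of a nonnegative quadratic functional, hence form a subspace. These two subspaces
  cover the space of all functionals, so one of them is everything.\<close>

lemma form_inf_dual_comparable:
  assumes inf: "is_form_inf t w m" and t: "is_form t" and w: "is_form w"
  shows "(\<forall>\<phi>. bounded_wrt t \<phi> \<and> bounded_wrt w \<phi> \<longrightarrow> dual_quad t \<phi> \<le> dual_quad w \<phi>) \<or>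
    (\<forall>\<phi>. bounded_wrt t \<phi> \<and> bounded_wrt w \<phi> \<longrightarrow> dual_quad w \<phi> \<le> dual_quad t \<phi>)"
proof (rule ccontr)
  assume "\<not> ?thesis"
  then obtain \<phi> \<psi> where \<phi>: "bounded_wrt t \<phi>" "bounded_wrt w \<phi>" "dual_quad w \<phi> < dual_quad t \<phi>"
    and \<psi>: "bounded_wrt t \<psi>" "bounded_wrt w \<psi>" "dual_quad t \<psi> < dual_quad w \<psi>"
    by (auto simp: not_le)
  have m: "is_form m" using inf by (simp add: is_form_inf_def)
  let ?D = "\<lambda>\<phi>. bounded_wrt t \<phi> \<and> bounded_wrt w \<phi>"
  have mx: "dual_quad m \<phi> = max (dual_quad t \<phi>) (dual_quad w \<phi>)" if "?D \<phi>" for \<phi>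
    using dual_quad_form_inf[OF inf t w] that by blast
  have bm: "bounded_wrt m \<phi>" if "?D \<phi>" for \<phi>
    using form_inf_bounded_wrt[OF inf t w] that by blast
  have closed: "?D (\<lambda>x. \<phi> x + \<psi> x)" "?D (\<lambda>x. \<phi> x - \<psi> x)" if "?D \<phi>" "?D \<psi>" for \<phi> \<psi>
    using that by (auto intro: bounded_wrt_add bounded_wrt_diff)
  \<comment> \<open>The dual of \<open>m\<close> minus that of \<open>s\<close> is nonnegative and
    obeys the parallelogram law, so vanishing at \<phi> and \<psi> forces it to vanish at their sum
    and difference.\<close>
  have sub: "dual_quad m (\<lambda>x. \<phi> x - \<psi> x) = dual_quad s (\<lambda>x. \<phi> x - \<psi> x)"
    if D: "?D \<phi>" "?D \<psi>" and s: "s = t \<or> s = w"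
      and eq: "dual_quad m \<phi> = dual_quad s \<phi>" "dual_quad m \<psi> = dual_quad s \<psi>" for \<phi> \<psi> s
  proof -
    have "is_form s" "bounded_wrt s \<phi>" "bounded_wrt s \<psi>" using D s t w by auto
    from dual_quad_parallelogram[OF this] dual_quad_parallelogram[OF m bm bm, OF D] eq
    show ?thesis
      using mx[OF closed(1)[OF D]] mx[OF closed(2)[OF D]] s by (auto simp: max_def split: if_splits)
  qed
  \<comment> \<open>If \<chi> lies in the subspace of \<open>t\<close>, so does
    \<open>\<chi> - \<phi> = \<psi>\<close>; if in that of \<open>w\<close>, so does
    \<open>\<chi> - \<psi> = \<phi>\<close>. Either contradicts a strict inequality.\<close>
  let ?\<chi> = "\<lambda>x. \<phi> x + \<psi> x"
  have D: "?D \<phi>" "?D \<psi>" "?D ?\<chi>" using \<phi> \<psi> closed by blast+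
  have "dual_quad m ?\<chi> = dual_quad t ?\<chi> \<or> dual_quad m ?\<chi> = dual_quad w ?\<chi>"
    using mx[OF D(3)] by (simp add: max_def)
  then show False
    using sub[OF D(3,1), of t] sub[OF D(3,2), of w] mx[OF D(1)] mx[OF D(2)] \<phi>(3) \<psi>(3)
    by auto
qed

text \<open>By the Cauchy--Schwarz inequality, a form \<open>u\<close> is recovered from the functionals
  \<open>u(\<cdot>, x)\<close> that it dominates.\<close>

lemma D_form_le_of_dual_le:
  assumes t: "is_form t" and w: "is_form w"
    and dual: "\<And>\<phi>. bounded_wrt t \<phi> \<Longrightarrow> bounded_wrt w \<phi> \<Longrightarrow> dual_quad w \<phi> \<le> dual_quad t \<phi>"
  shows "form_le (D_form w t) w"
  unfolding form_le_def
proof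
  fix x
  have "quad (parallel_sum t (\<lambda>x y. of_nat n * w x y)) x \<le> quad w x" for n
  proof -
    define u where "u = parallel_sum t (\<lambda>x y. of_nat n * w x y)"
    define c where "c = quad u x"
    \<comment> \<open>By Cauchy-Schwarz the square of this functional is at most \<open>c u\<close>,
      hence at most \<open>c t\<close> and \<open>c n w\<close>.\<close>
    define \<phi> where "\<phi> y = u y x" for y
    note nw = form_of_nat_mult[OF w, of n]
    have u: "is_form u" unfolding u_def by (rule parallel_sum_form[OF t nw])
    have ut: "quad u y \<le> quad t y" for y unfolding u_def by (rule parallel_sum_le_left[OF t nw])
    have uw: "quad u y \<le> real n * quad w y" for y
      using parallel_sum_le_right[OF t nw, of y] by (simp add: u_def quad_of_nat_mult)
    have c: "0 \<le> c" unfolding c_def by (rule quad_nonneg[OF u])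
    have lin: "linear_functional \<phi>"
      by (simp add: linear_functional_def \<phi>_def form_add_left[OF u] form_scale_left[OF u])
    have CS: "(cmod (\<phi> y))\<^sup>2 \<le> c * quad u y" for y
      using form_cauchy_schwarz[OF u, of y x] by (simp add: \<phi>_def c_def mult.commute)
    have bt: "(cmod (\<phi> y))\<^sup>2 \<le> c * quad t y" for y
      using CS[of y] mult_left_mono[OF ut[of y] c] by simp
    have bw: "(cmod (\<phi> y))\<^sup>2 \<le> (c * real n) * quad w y" for y
      using CS[of y] mult_left_mono[OF uw[of y] c] by (simp add: mult.assoc)
    have b: "bounded_wrt t \<phi>" "bounded_wrt w \<phi>"
      unfolding bounded_wrt_def using lin bt bw c by (auto intro: exI[of _ c] exI[of _ "c * real n"])
    have "dual_quad t \<phi> \<le> c"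
      using dual_quad_le_iff[OF t b(1) c] bt by simp
    \<comment> \<open>The hypothesis carries the constant \<open>c\<close> over from
      \<open>t\<close> to \<open>w\<close> and so removes the factor \<open>n\<close>; evaluation at
      \<open>x\<close> gives \<open>c * c <= c * w[x]\<close>.\<close>
    then have "dual_quad w \<phi> \<le> c" using dual[OF b] by simp
    then have "(cmod (\<phi> x))\<^sup>2 \<le> c * quad w x"
      using dual_quad_le_iff[OF w b(2) c] by simp
    moreover have "cmod (\<phi> x) = c" using c by (simp add: \<phi>_def c_def form_diag[OF u])
    ultimately have "c * c \<le> c * quad w x" by (simp add: power2_eq_square)
    then have "c \<le> quad w x"
      using c quad_nonneg[OF w, of x] by (cases "c = 0") auto
    then show ?thesis by (simp add: c_def u_def)
  qed
  then show "quad (D_form w t) x \<le> quad w x"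
    by (intro LIMSEQ_le_const2[OF D_form_spec(2)[OF t w]]) auto
qed

text \<open>\<open>D_form w t\<close> lies below \<open>t\<close>, and below \<open>w\<close> by the
  dual inequality; \<open>lower_bound_le_D_form\<close> with the two forms exchanged puts it below
  \<open>D_form t w\<close>.\<close>

lemma D_form_comparable:
  assumes t: "is_form t" and w: "is_form w"
    and dual: "\<And>\<phi>. bounded_wrt t \<phi> \<Longrightarrow> bounded_wrt w \<phi> \<Longrightarrow> dual_quad w \<phi> \<le> dual_quad t \<phi>"
  shows "form_le (D_form w t) (D_form t w)"
  by (rule lower_bound_le_D_form)
    (use assms D_form_spec(1) D_form_le D_form_le_of_dual_le in blast)+

text \<open>\<open>D_form w t\<close> dominates every common lower bound, and through
  \<open>D_form t w\<close> it lies below \<open>w\<close>.\<close>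

lemma D_form_is_inf:
  assumes t: "is_form t" and w: "is_form w" and le: "form_le (D_form w t) (D_form t w)"
  shows "is_form_inf t w (D_form w t)"
proof -
  have "form_le (D_form w t) w"
    using le D_form_le[OF w t] by (force simp: form_le_def intro: order_trans)
  then show ?thesis
    using D_form_spec(1)[OF t w] D_form_le[OF t w] lower_bound_le_D_form[OF _ t w]
    by (auto simp: is_form_inf_def)
qed

lemma is_form_inf_commute: "is_form_inf t w m \<longleftrightarrow> is_form_inf w t m"
  by (auto simp: is_form_inf_def)

text \<open>An infimum makes the duals comparable, and each direction of that comparison yields one
  disjunct; conversely, the smaller of the two parts is the infimum.\<close>

theorem form_inf_exists_iff:
  assumes t: "is_form t" and w: "is_form w"
  shows "(\<exists>m. is_form_inf t w m) \<longleftrightarrow>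
    form_le (D_form t w) (D_form w t) \<or> form_le (D_form w t) (D_form t w)"
proof
  assume "\<exists>m. is_form_inf t w m"
  then show "form_le (D_form t w) (D_form w t) \<or> form_le (D_form w t) (D_form t w)"
    using form_inf_dual_comparable[OF _ t w] D_form_comparable[OF t w] D_form_comparable[OF w t]
    by blast
next
  assume "form_le (D_form t w) (D_form w t) \<or> form_le (D_form w t) (D_form t w)"
  then show "\<exists>m. is_form_inf t w m"
    using D_form_is_inf[OF t w] D_form_is_inf[OF w t] is_form_inf_commute by blast
qed

section \<open>Kernels and their forms\<close>

lemma lookup_scaleC:
  "Poly_Mapping.lookup (c *\<^sub>C f) s = c *\<^sub>C Poly_Mapping.lookup (f :: 's \<Rightarrow>\<^sub>0 'e::complex_vector) s"
  by (simp add: scaleC_poly_mapping_def Poly_Mapping.map.rep_eq when_def)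

lemma keys_scaleC: "Poly_Mapping.keys (c *\<^sub>C f) \<subseteq> Poly_Mapping.keys (f :: 's \<Rightarrow>\<^sub>0 'e::complex_vector)"
  by (auto simp: in_keys_iff lookup_scaleC)

lemma dual_pairing_add_left: "dual_pairing (x + y) \<phi> = dual_pairing x \<phi> + dual_pairing y \<phi>"
  and dual_pairing_add_right: "dual_pairing x (\<phi> + \<psi>) = dual_pairing x \<phi> + dual_pairing x \<psi>"
  and dual_pairing_zero [simp]: "dual_pairing 0 \<phi> = 0" "dual_pairing x 0 = 0"
  by (simp_all add: dual_pairing_def blinfun.bilinear_simps)

text \<open>Lets several functions be summed over one common finite set, as additivity
  requires.\<close>

lemma assoc_form_eq_sum:
  assumes "finite A" "finite B" "Poly_Mapping.keys f \<subseteq> A" "Poly_Mapping.keys g \<subseteq> B"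
  shows "assoc_form K f g = (\<Sum>s\<in>B. \<Sum>t\<in>A.
    dual_pairing (Poly_Mapping.lookup f t) (blinfun_apply (K s t) (Poly_Mapping.lookup g s)))"
proof -
  have "(\<Sum>t\<in>Poly_Mapping.keys f. dual_pairing (Poly_Mapping.lookup f t) (blinfun_apply (K s t) x)) =
      (\<Sum>t\<in>A. dual_pairing (Poly_Mapping.lookup f t) (blinfun_apply (K s t) x))" for s x
    by (rule sum.mono_neutral_left) (use assms in \<open>auto simp: in_keys_iff\<close>)
  then show ?thesis
    unfolding assoc_form_def
    by (simp, intro sum.mono_neutral_left) (use assms in \<open>auto simp: in_keys_iff\<close>)
qed

lemma assoc_form_single:
  "assoc_form K (Poly_Mapping.single t y) (Poly_Mapping.single s x) = dual_pairing y (blinfun_apply (K s t) x)"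
  by (subst assoc_form_eq_sum[of "{t}" "{s}"]) auto

lemma is_form_assoc_form:
  fixes K :: "'s \<Rightarrow> 's \<Rightarrow> 'e::complex_banach \<Rightarrow>\<^sub>L 'e \<Rightarrow>\<^sub>L complex"
  assumes "is_kernel K"
  shows "is_form (assoc_form K)"
proof -
  have scale_left: "dual_pairing (c *\<^sub>C x) (blinfun_apply (K s t) y) = c * dual_pairing x (blinfun_apply (K s t) y)"
    and scale_right: "dual_pairing x (blinfun_apply (K s t) (c *\<^sub>C y)) = cnj c * dual_pairing x (blinfun_apply (K s t) y)"
    for c x y s t
    using assms
    by (auto simp: is_kernel_def bounded_operators_to_dual_def topological_dual_def dual_pairing_def)
  show ?thesis
    unfolding is_form_def
  proof (intro conjI allI)
    fix f g h :: "'s \<Rightarrow>\<^sub>0 'e" and c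
    let ?A = "Poly_Mapping.keys f \<union> Poly_Mapping.keys g" and ?B = "Poly_Mapping.keys h"
    have sub: "Poly_Mapping.keys (f + g) \<subseteq> ?A" "Poly_Mapping.keys (c *\<^sub>C f) \<subseteq> ?A"
      using Poly_Mapping.keys_add[of f g] keys_scaleC[of c f] by auto
    have L: "assoc_form K k h = (\<Sum>s\<in>?B. \<Sum>t\<in>?A. dual_pairing (Poly_Mapping.lookup k t)
        (blinfun_apply (K s t) (Poly_Mapping.lookup h s)))" if "Poly_Mapping.keys k \<subseteq> ?A" for k
      using that by (intro assoc_form_eq_sum) auto
    have R: "assoc_form K h k = (\<Sum>s\<in>?A. \<Sum>t\<in>?B. dual_pairing (Poly_Mapping.lookup h t)
        (blinfun_apply (K s t) (Poly_Mapping.lookup k s)))" if "Poly_Mapping.keys k \<subseteq> ?A" for k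
      using that by (intro assoc_form_eq_sum) auto
    show "assoc_form K (f + g) h = assoc_form K f h + assoc_form K g h"
      by (simp add: L sub lookup_add dual_pairing_add_left sum.distrib)
    show "assoc_form K h (f + g) = assoc_form K h f + assoc_form K h g"
      by (simp add: R sub lookup_add dual_pairing_add_right sum.distrib blinfun.add_right)
    show "assoc_form K (c *\<^sub>C f) h = c * assoc_form K f h"
      by (simp add: L sub lookup_scaleC scale_left sum_distrib_left)
    show "assoc_form K h (c *\<^sub>C f) = cnj c * assoc_form K h f"
      by (simp add: R sub lookup_scaleC scale_right sum_distrib_left)
    show "assoc_form K f f \<in> \<real>\<^sub>\<ge>\<^sub>0" using assms by (simp add: is_kernel_def)
  qed
qed

text \<open>Functions supported at one point recover each entry. This gives the uniqueness in
  \<open>D_kernel\<close>.\<close>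

lemma assoc_form_inject:
  assumes "assoc_form M = assoc_form N"
  shows "M = N"
proof (intro ext blinfun_eqI)
  fix s t x y
  show "blinfun_apply (blinfun_apply (M s t) x) y = blinfun_apply (blinfun_apply (N s t) x) y"
    using assoc_form_single[of M t y s x] assoc_form_single[of N t y s x] assms
    by (simp add: dual_pairing_def)
qed

section \<open>Kernels of dominated forms\<close>

lemma form_sum_left: "is_form u \<Longrightarrow> u (sum f A) z = (\<Sum>a\<in>A. u (f a) z)"
  by (induction A rule: infinite_finite_induct) (simp_all add: form_zero_left form_add_left)

lemma form_sum_right: "is_form u \<Longrightarrow> u z (sum f A) = (\<Sum>a\<in>A. u z (f a))"
  by (induction A rule: infinite_finite_induct) (simp_all add: form_zero_right form_add_right)

lemma sum_single_keys:
  "(\<Sum>s\<in>Poly_Mapping.keys f. Poly_Mapping.single s (Poly_Mapping.lookup f s)) = f"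
  by (rule poly_mapping_eqI)
    (simp add: lookup_sum lookup_single when_def in_keys_iff sum.delta)

lemma single_scaleC: "Poly_Mapping.single s (c *\<^sub>C x) = c *\<^sub>C Poly_Mapping.single s (x::'e::complex_vector)"
  by (rule poly_mapping_eqI) (simp add: lookup_scaleC lookup_single when_def)

text \<open>The Cauchy--Schwarz inequality for \<open>u\<close> and the bound by the diagonal of \<open>K\<close> make the entries
  of \<open>u\<close> bounded operators.\<close>

lemma form_le_assoc_form_imp_kernel:
  fixes K :: "'s \<Rightarrow> 's \<Rightarrow> 'e::complex_banach \<Rightarrow>\<^sub>L 'e \<Rightarrow>\<^sub>L complex"
  assumes K: "is_kernel K" and u: "is_form u" and le: "form_le u (assoc_form K)"
  obtains M where "is_kernel M" "assoc_form M = u"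
proof -
  \<comment> \<open>The future entry at \<open>(s, t)\<close>; as in \<open>assoc_form\<close>,
    \<open>s\<close> belongs to the second argument of the form and \<open>t\<close> to the
    first.\<close>
  define v where "v s t x y = u (Poly_Mapping.single t y) (Poly_Mapping.single s x)" for s t and x y :: 'e
  have diag: "quad u (Poly_Mapping.single s x) \<le> norm (K s s) * (norm x)\<^sup>2" for s x
  proof -
    have "quad u (Poly_Mapping.single s x) \<le> cmod (blinfun_apply (blinfun_apply (K s s) x) x)"
      using le[unfolded form_le_def, rule_format, of "Poly_Mapping.single s x"]
        complex_Re_le_cmod[of "blinfun_apply (blinfun_apply (K s s) x) x"]
      by (simp add: quad_def[of "assoc_form K"] assoc_form_single dual_pairing_def)
    also have "\<dots> \<le> norm (blinfun_apply (K s s) x) * norm x" by (rule norm_blinfun)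
    also have "\<dots> \<le> norm (K s s) * norm x * norm x"
      by (intro mult_right_mono norm_blinfun) simp
    finally show ?thesis by (simp add: power2_eq_square)
  qed
  have bound: "cmod (v s t x y) \<le> sqrt (norm (K s s) * norm (K t t)) * norm x * norm y" for s t x y
  proof (rule power2_le_imp_le)
    have "(cmod (v s t x y))\<^sup>2 \<le> quad u (Poly_Mapping.single t y) * quad u (Poly_Mapping.single s x)"
      unfolding v_def by (rule form_cauchy_schwarz[OF u])
    also have "\<dots> \<le> (norm (K t t) * (norm y)\<^sup>2) * (norm (K s s) * (norm x)\<^sup>2)"
      by (intro mult_mono diag quad_nonneg[OF u]) simp
    finally show "(cmod (v s t x y))\<^sup>2 \<le> (sqrt (norm (K s s) * norm (K t t)) * norm x * norm y)\<^sup>2"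
      by (simp add: power_mult_distrib algebra_simps)
  qed simp
  have add: "v s t (x + x') y = v s t x y + v s t x' y" "v s t x (y + y') = v s t x y + v s t x y'" for s t x x' y y'
    by (simp_all add: v_def single_add form_add_left[OF u] form_add_right[OF u])
  have scale: "v s t (c *\<^sub>C x) y = cnj c * v s t x y" "v s t x (c *\<^sub>C y) = c * v s t x y" for s t c x y
    by (simp_all add: v_def single_scaleC form_scale_left[OF u] form_scale_right[OF u])
  have lin: "bounded_linear (v s t x)" for s t x
    by (rule bounded_linear_intro[of _ "sqrt (norm (K s s) * norm (K t t)) * norm x"])
      (use bound[of s t x] in \<open>simp_all add: add scaleR_scaleC scale scaleC_complex_def algebra_simps\<close>)
  have lin': "bounded_linear (\<lambda>x. Blinfun (v s t x))" for s t
  proof (rule bounded_linear_intro)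
    show "norm (Blinfun (v s t x)) \<le> norm x * sqrt (norm (K s s) * norm (K t t))" for x
      by (rule norm_blinfun_bound)
        (use bound[of s t x] in \<open>simp_all add: bounded_linear_Blinfun_apply[OF lin] mult.commute\<close>)
  qed (auto intro!: blinfun_eqI simp: bounded_linear_Blinfun_apply[OF lin] add scaleR_scaleC scale
      blinfun.bilinear_simps scaleC_complex_def)
  \<comment> \<open>The type records only real linearity; \<open>scale\<close> later supplies
    complex linearity into the dual, which is conjugate linearity of \<open>v\<close> in
    \<open>x\<close>.\<close>
  define M where "M s t = Blinfun (\<lambda>x. Blinfun (v s t x))" for s t
  have M: "dual_pairing y (blinfun_apply (M s t) x) = v s t x y" for s t x y
    by (simp add: M_def dual_pairing_def bounded_linear_Blinfun_apply[OF lin] bounded_linear_Blinfun_apply[OF lin'])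
  have "assoc_form M f g = u f g" for f g
  proof -
    have "u f g = u (\<Sum>t\<in>Poly_Mapping.keys f. Poly_Mapping.single t (Poly_Mapping.lookup f t))
        (\<Sum>s\<in>Poly_Mapping.keys g. Poly_Mapping.single s (Poly_Mapping.lookup g s))"
      by (simp only: sum_single_keys)
    also have "\<dots> = assoc_form M f g"
      by (simp add: form_sum_left[OF u] form_sum_right[OF u] assoc_form_def M v_def)
    finally show ?thesis by simp
  qed
  then have eq: "assoc_form M = u" by blast
  have "M s t \<in> bounded_operators_to_dual" for s t
    unfolding bounded_operators_to_dual_def topological_dual_def
    by (simp add: M scale flip: dual_pairing_def)
  then have "is_kernel M"
    using form_nonneg_Reals[OF u] by (simp add: is_kernel_def eq)
  then show thesis using that eq by blast
qed

text \<open>By \<open>D_form_le\<close> the form on the right lies below that of \<open>K\<close>,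
  so it comes from a kernel, and injectivity makes this kernel unique.\<close>

lemma assoc_form_D_kernel:
  fixes K L :: "'s \<Rightarrow> 's \<Rightarrow> 'e::complex_banach \<Rightarrow>\<^sub>L 'e \<Rightarrow>\<^sub>L complex"
  assumes "is_kernel K" "is_kernel L"
  shows "assoc_form (D_kernel L K) = D_form (assoc_form L) (assoc_form K)"
proof -
  note forms = is_form_assoc_form[OF assms(1)] is_form_assoc_form[OF assms(2)]
  obtain M where M: "is_kernel M" "assoc_form M = D_form (assoc_form L) (assoc_form K)"
    using form_le_assoc_form_imp_kernel[OF assms(1) D_form_spec(1)[OF forms] D_form_le[OF forms]] .
  moreover have "N = M" if "assoc_form N = D_form (assoc_form L) (assoc_form K)" for N
    by (rule assoc_form_inject) (simp add: that M(2))
  ultimately have "\<exists>!M. is_kernel M \<and> assoc_form M = D_form (assoc_form L) (assoc_form K)"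
    by metis
  then show ?thesis
    unfolding D_kernel_def by (rule theI'[THEN conjunct2])
qed

text \<open>Forms below that of \<open>K\<close> are forms of kernels, so common lower bounds among
  kernels and among forms correspond, and so do the greatest ones.\<close>

lemma kernel_inf_exists_iff:
  fixes K L :: "'s \<Rightarrow> 's \<Rightarrow> 'e::complex_banach \<Rightarrow>\<^sub>L 'e \<Rightarrow>\<^sub>L complex"
  assumes K: "is_kernel K" and L: "is_kernel L"
  shows "(\<exists>M. is_kernel_inf K L M) \<longleftrightarrow> (\<exists>m. is_form_inf (assoc_form K) (assoc_form L) m)"
proof
  assume "\<exists>M. is_kernel_inf K L M"
  then obtain M where M: "is_kernel_inf K L M" ..
  have "is_form_inf (assoc_form K) (assoc_form L) (assoc_form M)"
    unfolding is_form_inf_def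
  proof (intro conjI allI impI)
    fix u
    assume u: "is_form u \<and> form_le u (assoc_form K) \<and> form_le u (assoc_form L)"
    then obtain U where "is_kernel U" "assoc_form U = u"
      using form_le_assoc_form_imp_kernel[OF K] by blast
    then show "form_le u (assoc_form M)"
      using M u by (auto simp: is_kernel_inf_def kernel_le_def)
  qed (use M in \<open>auto simp: is_kernel_inf_def kernel_le_def is_form_assoc_form\<close>)
  then show "\<exists>m. is_form_inf (assoc_form K) (assoc_form L) m" by blast
next
  assume "\<exists>m. is_form_inf (assoc_form K) (assoc_form L) m"
  then obtain m where m: "is_form_inf (assoc_form K) (assoc_form L) m" ..
  then obtain M where "is_kernel M" "assoc_form M = m"
    using form_le_assoc_form_imp_kernel[OF K] unfolding is_form_inf_def by blast
  then have "is_kernel_inf K L M"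
    using m by (auto simp: is_form_inf_def is_kernel_inf_def kernel_le_def is_form_assoc_form)
  then show "\<exists>M. is_kernel_inf K L M" by blast
qed

theorem corollary2p7:
  fixes K L :: "'s \<Rightarrow> 's \<Rightarrow> 'e::complex_banach \<Rightarrow>\<^sub>L 'e \<Rightarrow>\<^sub>L complex"
  assumes "is_kernel K" and "is_kernel L"
  shows "(\<exists>M. is_kernel_inf K L M) \<longleftrightarrow>
         kernel_le (D_kernel K L) (D_kernel L K) \<or> kernel_le (D_kernel L K) (D_kernel K L)"
  unfolding kernel_inf_exists_iff[OF assms] kernel_le_def
    assoc_form_D_kernel[OF assms] assoc_form_D_kernel[OF assms(2,1)]
  by (rule form_inf_exists_iff[OF is_form_assoc_form[OF assms(1)] is_form_assoc_form[OF assms(2)]])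

end
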